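(* Let $\mathcal A=\{\mathbf A_0,\dots,\mathbf A_{k-1}\}$ be a finite set of $d\times d$ (entrywise) nonnegative real matrices and $\mathbf A=\sum_{j=0}^{k-1}\mathbf A_j$. If $\rho^*(\mathcal A)=\rho(\mathbf A)$, then $\mathcal A$ has the finiteness property.
   Context: $\rho(\cdot)$ is the spectral radius and $\rho^*(\mathcal A)=\lim_{n\to\infty}\max_{0\le i_1,\dots,i_n\le k-1}\|\mathbf A_{i_1}\cdots\mathbf A_{i_n}\|^{1/n}$ is the joint spectral radius (any submultiplicative matrix norm). $\mathcal A$ has the finiteness property if there is a finite product $\mathbf A_{i_0}\cdots\mathbf A_{i_{m-1}}$ ($m\ge1$) of matrices from $\mathcal A$ with $\rho(\mathbf A_{i_0}\cdots\mathbf A_{i_{m-1}})^{1/m}=\rho^*(\mathcal A)$. *)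

theory Defs
  imports "Jordan_Normal_Form.Spectral_Radius"
begin

(* A system of k real d x d matrices is given as a family A :: nat => real mat, of which
   only A 0, ..., A (k - 1) matter. The library's spectral radius is defined for complex
   matrices, so real matrices are embedded first. *)

definition real_spectral_radius :: "real mat \<Rightarrow> real" where
  "real_spectral_radius M = spectral_radius (map_mat complex_of_real M)"

definition nonneg_matrix :: "real mat \<Rightarrow> bool" where
  "nonneg_matrix M \<longleftrightarrow> (\<forall>i < dim_row M. \<forall>j < dim_col M. 0 \<le> M $$ (i, j))"

definition matrix_sum :: "nat \<Rightarrow> nat \<Rightarrow> (nat \<Rightarrow> real mat) \<Rightarrow> real mat" where
  "matrix_sum d k A = mat d d (\<lambda>(i, j). \<Sum>l<k. A l $$ (i, j))"

definition words :: "nat \<Rightarrow> nat \<Rightarrow> nat list set" where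
  "words k n = {w. length w = n \<and> set w \<subseteq> {..<k}}"

definition word_product :: "nat \<Rightarrow> (nat \<Rightarrow> real mat) \<Rightarrow> nat list \<Rightarrow> real mat" where
  "word_product d A w = foldr (\<lambda>i M. A i * M) w (1\<^sub>m d)"

definition submultiplicative_norm :: "nat \<Rightarrow> (real mat \<Rightarrow> real) \<Rightarrow> bool" where
  "submultiplicative_norm d N \<longleftrightarrow>
     (\<forall>M \<in> carrier_mat d d. 0 \<le> N M \<and> (N M = 0 \<longleftrightarrow> M = 0\<^sub>m d d)) \<and>
     (\<forall>c. \<forall>M \<in> carrier_mat d d. N (c \<cdot>\<^sub>m M) = \<bar>c\<bar> * N M) \<and>
     (\<forall>M \<in> carrier_mat d d. \<forall>M' \<in> carrier_mat d d. N (M + M') \<le> N M + N M') \<and>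
     (\<forall>M \<in> carrier_mat d d. \<forall>M' \<in> carrier_mat d d. N (M * M') \<le> N M * N M')"

(* The value does not depend on the submultiplicative norm N; it is kept as a parameter so
   that statements can quantify over all of them. Meaningful for 0 < k; the term n = 0 is
   irrelevant to the limit. *)

definition joint_spectral_radius ::
  "(real mat \<Rightarrow> real) \<Rightarrow> nat \<Rightarrow> nat \<Rightarrow> (nat \<Rightarrow> real mat) \<Rightarrow> real" where
  "joint_spectral_radius N d k A =
     lim (\<lambda>n. Max ((\<lambda>w. root n (N (word_product d A w))) ` words k n))"

definition finiteness_property ::
  "(real mat \<Rightarrow> real) \<Rightarrow> nat \<Rightarrow> nat \<Rightarrow> (nat \<Rightarrow> real mat) \<Rightarrow> bool" where
  "finiteness_property N d k A \<longleftrightarrow>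
     (\<exists>m \<ge> 1. \<exists>w \<in> words k m.
        root m (real_spectral_radius (word_product d A w)) = joint_spectral_radius N d k A)"

end

theory Submission
  imports Defs
begin

text \<open>
  Let \<open>\<rho>\<close> be the common value and \<open>S\<close> the sum of the matrices. For every \<open>e > 0\<close> a partial
  Neumann series gives a positive vector \<open>v\<close> with \<open>S v \<le> (\<rho> + e) v\<close>. Since the joint spectral
  radius is \<open>\<rho>\<close>, in the norm weighted by \<open>v\<close> some product \<open>P w\<close> of length \<open>n\<close> has
  \<open>(P w v) i \<ge> \<rho>^n v i\<close>. Letting \<open>e\<close> tend to \<open>0\<close> with \<open>i\<close> and \<open>w\<close> fixed, and normalising by \<open>v i\<close>
  on the set \<open>R\<close> of indices reachable from \<open>i\<close>, yields \<open>u \<ge> 0\<close> with \<open>u i = 1\<close>, \<open>S u \<le> \<rho> u\<close> on \<open>R\<close>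
  and \<open>(P w u) i \<ge> \<rho>^n\<close>. So no weight is lost along \<open>w\<close>: equality holds at each index reached from
  \<open>i\<close> by a prefix of \<open>w\<close>. If \<open>n = 2^d\<close>, two prefixes reach the same set \<open>T\<close> of indices, and for
  the factor \<open>z\<close> of \<open>w\<close> between them the restriction of \<open>u\<close> to \<open>T\<close> satisfies \<open>P z u \<ge> \<rho>^|z| u\<close>.
  Hence the spectral radius of \<open>P z\<close> is at least \<open>\<rho>^|z|\<close>; it is at most that because \<open>P z\<close> is
  entrywise below a power of \<open>S\<close>.
\<close>

section \<open>Matrices acting on real vectors\<close>

text \<open>Vectors are total functions on \<open>nat\<close>, so no carrier has to be tracked. The
  value 0 outside the range makes \<open>mat_apply_mult\<close> an equation between
  functions.\<close>

definition mat_apply :: "nat \<Rightarrow> real mat \<Rightarrow> (nat \<Rightarrow> real) \<Rightarrow> nat \<Rightarrow> real" where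
  "mat_apply d M x i = (if i < d then \<Sum>j<d. M $$ (i, j) * x j else 0)"

lemma mat_apply_mult:
  assumes "M \<in> carrier_mat d d" "M' \<in> carrier_mat d d"
  shows "mat_apply d (M * M') x = mat_apply d M (mat_apply d M' x)"
proof
  fix i
  show "mat_apply d (M * M') x i = mat_apply d M (mat_apply d M' x) i"
  proof (cases "i < d")
    case True
    have "mat_apply d (M * M') x i = (\<Sum>j<d. (\<Sum>l<d. M $$ (i,l) * M' $$ (l,j)) * x j)"
      using True assms by (simp add: mat_apply_def scalar_prod_def lessThan_atLeast0)
    also have "\<dots> = (\<Sum>l<d. \<Sum>j<d. M $$ (i,l) * M' $$ (l,j) * x j)"
      by (subst sum.swap) (simp add: sum_distrib_right)
    also have "\<dots> = mat_apply d M (mat_apply d M' x) i"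
      using True by (simp add: mat_apply_def sum_distrib_left mult.assoc)
    finally show ?thesis .
  qed (simp add: mat_apply_def)
qed

lemma mat_apply_scale: "mat_apply d M (\<lambda>i. c * x i) i = c * mat_apply d M x i"
  by (simp add: mat_apply_def sum_distrib_left mult.left_commute)

lemma mat_apply_sum: "mat_apply d M (\<lambda>i. \<Sum>k\<in>K. x k i) i = (\<Sum>k\<in>K. mat_apply d M (x k) i)"
proof (cases "i < d")
  case True
  then show ?thesis
    by (simp add: mat_apply_def sum_distrib_left) (rule sum.swap)
qed (simp add: mat_apply_def)

lemma nonneg_matrixD:
  "nonneg_matrix M \<Longrightarrow> M \<in> carrier_mat d d \<Longrightarrow> i < d \<Longrightarrow> j < d \<Longrightarrow> 0 \<le> M $$ (i, j)"
  by (auto simp: nonneg_matrix_def)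

lemma mat_apply_mono:
  assumes "nonneg_matrix M" "M \<in> carrier_mat d d" "\<And>j. j < d \<Longrightarrow> x j \<le> y j"
  shows "mat_apply d M x i \<le> mat_apply d M y i"
  using assms unfolding mat_apply_def
  by (auto intro!: sum_mono mult_left_mono nonneg_matrixD)

lemma mat_apply_nonneg:
  assumes "nonneg_matrix M" "M \<in> carrier_mat d d" "\<And>j. j < d \<Longrightarrow> 0 \<le> x j"
  shows "0 \<le> mat_apply d M x i"
  using mat_apply_mono[OF assms(1,2), of "\<lambda>_. 0" x i] assms(3) by (simp add: mat_apply_def split: if_splits)

lemma mat_apply_one:
  assumes "i < d"
  shows "mat_apply d (1\<^sub>m d) x i = x i"
proof -
  have "mat_apply d (1\<^sub>m d) x i = (\<Sum>j<d. if i = j then x j else 0)"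
    using assms by (auto simp: mat_apply_def simp del: sum.delta sum.delta' intro!: sum.cong)
  then show ?thesis using assms by simp
qed

lemma mat_apply_pow:
  assumes "M \<in> carrier_mat d d" "i < d"
  shows "mat_apply d (M ^\<^sub>m k) x i = (mat_apply d M ^^ k) x i"
  using assms(2)
proof (induction k arbitrary: x i)
  case 0
  then show ?case using assms by (auto simp: mat_apply_one)
next
  case (Suc k)
  have "mat_apply d (M ^\<^sub>m Suc k) x = mat_apply d (M ^\<^sub>m k) (mat_apply d M x)"
    using assms by (simp add: mat_apply_mult)
  then show ?case using Suc by (simp add: funpow_swap1)
qed

section \<open>Collatz-Wielandt bounds for the spectral radius\<close>

lemma spectral_radius_eigenvector:
  assumes M: "M \<in> carrier_mat d d" and d: "d \<ge> 1"
  obtains a y where "norm a = real_spectral_radius M" "\<exists>i<d. y i \<noteq> (0::complex)"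
    "\<And>i. i < d \<Longrightarrow> (\<Sum>j<d. complex_of_real (M $$ (i, j)) * y j) = a * y i"
proof -
  let ?M = "map_mat complex_of_real M"
  have cM: "?M \<in> carrier_mat d d" using M by auto
  from spectral_radius_mem_max(1)[OF cM] d obtain a where
    a: "a \<in> spectrum ?M" "norm a = real_spectral_radius M"
    by (auto simp: real_spectral_radius_def)
  from a(1) obtain v where v: "eigenvector ?M v a"
    by (auto simp: spectrum_def eigenvalue_def)
  then have vd: "v \<in> carrier_vec d" "v \<noteq> 0\<^sub>v d" "?M *\<^sub>v v = a \<cdot>\<^sub>v v"
    using cM by (auto simp: eigenvector_def)
  show ?thesis
  proof (rule that[of a "\<lambda>i. v $ i"])
    show "\<exists>i<d. v $ i \<noteq> 0" using vd(1,2) by auto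
    fix i assume i: "i < d"
    have "(?M *\<^sub>v v) $ i = a * v $ i" using vd i by simp
    then show "(\<Sum>j<d. complex_of_real (M $$ (i, j)) * v $ j) = a * v $ i"
      using i M vd(1) by (simp add: scalar_prod_def lessThan_atLeast0)
  qed (use a in auto)
qed

text \<open>Take an eigenvector \<open>y\<close> for an eigenvalue \<open>a\<close> of maximal
  modulus and the index \<open>i\<close> that maximises \<open>norm (y i) / v i\<close>. Taking
  norms in row \<open>i\<close> gives
  \<open>norm a * norm (y i) \<le> c * norm (y i)\<close>.\<close>

lemma spectral_radius_le_of_supersolution:
  assumes M: "M \<in> carrier_mat d d" and d: "d \<ge> 1" and nn: "nonneg_matrix M"
    and v: "\<And>i. i < d \<Longrightarrow> 0 < v i" and Mv: "\<And>i. i < d \<Longrightarrow> mat_apply d M v i \<le> c * v i"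
  shows "real_spectral_radius M \<le> c"
proof -
  from spectral_radius_eigenvector[OF M d] obtain a y where
    a: "norm a = real_spectral_radius M" and y: "\<exists>i<d. y i \<noteq> (0::complex)"
    and e: "\<And>i. i < d \<Longrightarrow> (\<Sum>j<d. complex_of_real (M $$ (i, j)) * y j) = a * y i" by metis
  let ?f = "\<lambda>i. norm (y i) / v i"
  have fin: "finite (?f ` {..<d})" "?f ` {..<d} \<noteq> {}" using d by (auto simp: lessThan_empty_iff)
  from Max_in[OF fin] obtain i where i: "i < d" "?f i = Max (?f ` {..<d})" by auto
  define t where "t = ?f i"
  have le: "norm (y j) \<le> t * v j" if "j < d" for j
  proof -
    have "?f j \<le> t" using Max_ge[OF fin(1), of "?f j"] that i(2) by (simp add: t_def)
    then show ?thesis using v[OF that] by (simp add: pos_divide_le_eq)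
  qed
  obtain j where j: "j < d" "y j \<noteq> 0" using y by blast
  have t: "0 < t" using le[OF j(1)] j v[OF j(1)] 
    by (metis zero_less_norm_iff less_le_trans zero_less_mult_pos2)
  have "norm a * norm (y i) = norm (\<Sum>j<d. complex_of_real (M $$ (i, j)) * y j)"
    using e[OF i(1)] by (simp add: norm_mult)
  also have "\<dots> \<le> (\<Sum>j<d. M $$ (i, j) * norm (y j))"
    by (rule order_trans[OF norm_sum]) (auto simp: norm_mult i nonneg_matrixD[OF nn M])
  also have "\<dots> = mat_apply d M (\<lambda>j. norm (y j)) i" using i by (simp add: mat_apply_def)
  also have "\<dots> \<le> mat_apply d M (\<lambda>j. t * v j) i" by (rule mat_apply_mono[OF nn M le])
  also have "\<dots> = t * mat_apply d M v i" by (rule mat_apply_scale)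
  also have "\<dots> \<le> t * (c * v i)" using t Mv[OF i(1)] by (simp add: mult_left_mono)
  also have "\<dots> = c * norm (y i)" using v[OF i(1)] by (simp add: t_def)
  finally have "norm a * norm (y i) \<le> c * norm (y i)" .
  moreover have "0 < norm (y i)" using t v[OF i(1)] by (simp add: t_def zero_less_divide_iff)
  ultimately show ?thesis using a by simp
qed

lemma real_spectral_radius_nonneg:
  assumes "M \<in> carrier_mat d d" "d \<ge> 1"
  shows "0 \<le> real_spectral_radius M"
  using spectral_radius_eigenvector[OF assms] by (metis norm_ge_zero)

lemma smult_smult_mat: "a \<cdot>\<^sub>m (b \<cdot>\<^sub>m M) = (a * b :: 'a :: semigroup_mult) \<cdot>\<^sub>m M"
  by (intro eq_matI) (auto simp: mult.assoc)

text \<open>Dividing by \<open>b\<close> brings the spectral radius below 1, and the Jordan normal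
  form bounds the powers of such a matrix. Undoing the scaling gives the factor
  \<open>b ^ k\<close>.\<close>

lemma pow_entries_bound:
  assumes M: "M \<in> carrier_mat d d" and d: "d \<ge> 1" and b: "real_spectral_radius M < b"
  shows "\<exists>C. \<forall>k. \<forall>i<d. \<forall>j<d. \<bar>(M ^\<^sub>m k) $$ (i, j)\<bar> \<le> C * b ^ k"
proof -
  have b0: "b > 0" using b real_spectral_radius_nonneg[OF M d] by simp
  let ?cM = "map_mat complex_of_real M"
  let ?B = "complex_of_real (1 / b) \<cdot>\<^sub>m ?cM"
  have cM: "?cM \<in> carrier_mat d d" using M by auto
  have B: "?B \<in> carrier_mat d d" using M by auto
  have "spectral_radius ?B < 1"
  proof -
    from spectral_radius_mem_max(1)[OF B] d obtain a where
      a: "a \<in> spectrum ?B" "norm a = spectral_radius ?B" by auto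
    from a(1) obtain v where v: "eigenvector ?B v a"
      by (auto simp: spectrum_def eigenvalue_def)
    then have vd: "v \<in> carrier_vec d" "v \<noteq> 0\<^sub>v d" "?B *\<^sub>v v = a \<cdot>\<^sub>v v"
      using B by (auto simp: eigenvector_def)
    have "?cM *\<^sub>v v = (of_real b * a) \<cdot>\<^sub>v v"
    proof (rule eq_vecI)
      fix i assume "i < dim_vec ((of_real b * a) \<cdot>\<^sub>v v)"
      then have i: "i < d" using vd by simp
      have "(?B *\<^sub>v v) $ i = a * v $ i" using vd i by simp
      moreover have "(?B *\<^sub>v v) $ i = of_real (1 / b) * (?cM *\<^sub>v v) $ i"
        using i M vd(1) by (simp add: scalar_prod_def sum_distrib_left sum_divide_distrib)
      ultimately show "(?cM *\<^sub>v v) $ i = ((of_real b * a) \<cdot>\<^sub>v v) $ i"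
        using i vd(1) b0 by (simp add: field_simps)
    qed (use vd M in auto)
    then have "eigenvector ?cM v (of_real b * a)"
      using vd M by (auto simp: eigenvector_def)
    then have "of_real b * a \<in> spectrum ?cM" by (auto simp: spectrum_def eigenvalue_def)
    then have "norm (of_real b * a) \<le> real_spectral_radius M"
      unfolding real_spectral_radius_def using spectral_radius_mem_max(2)[OF cM] d by auto
    then have "b * norm a \<le> real_spectral_radius M" using b0 by (simp add: norm_mult)
    then have "b * norm a < b * 1" using b by linarith
    then show ?thesis unfolding mult_less_cancel_left_pos[OF b0] a .
  qed
  from spectral_radius_jnf_norm_bound_less_1_upper_triangular[OF B this]
  obtain C where C: "\<And>k. norm_bound (?B ^\<^sub>m k) C" by auto
  have pow: "?B ^\<^sub>m k = complex_of_real ((1 / b) ^ k) \<cdot>\<^sub>m map_mat complex_of_real (M ^\<^sub>m k)" for k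
  proof (induction k)
    case (Suc k)
    let ?r = "complex_of_real (1 / b)" and ?P = "map_mat complex_of_real (M ^\<^sub>m k)"
    have P: "?P \<in> carrier_mat d d" using M by (simp add: pow_carrier_mat)
    have "?B ^\<^sub>m Suc k = (complex_of_real ((1 / b) ^ k) \<cdot>\<^sub>m ?P) * (?r \<cdot>\<^sub>m ?cM)"
      by (simp only: pow_mat.simps Suc)
    also have "\<dots> = complex_of_real ((1 / b) ^ k) \<cdot>\<^sub>m (?r \<cdot>\<^sub>m (?P * ?cM))"
      using P cM by (simp add: mult_smult_assoc_mat[OF P smult_carrier_mat[OF cM]] mult_smult_distrib[OF P cM])
    also have "?P * ?cM = map_mat complex_of_real (M ^\<^sub>m Suc k)"
      using M by (simp add: of_real_hom.mat_hom_mult[OF pow_carrier_mat[OF M] M])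
    finally show ?case
      by (metis smult_smult_mat power_Suc2 of_real_mult)
  qed (use M in \<open>auto intro!: eq_matI\<close>)
  have "\<bar>(M ^\<^sub>m k) $$ (i, j)\<bar> \<le> C * b ^ k" if "i < d" "j < d" for k i j
  proof -
    have "norm ((?B ^\<^sub>m k) $$ (i, j)) \<le> C"
      using C[of k] that carrier_matD[OF pow_carrier_mat[OF B, of k]]
      unfolding norm_bound_def by metis
    then show ?thesis using that M b0 unfolding pow
      by (simp add: norm_mult norm_power norm_divide power_one_over field_simps)
  qed
  then show ?thesis by blast
qed

text \<open>A Perron eigenvector can have zero entries; going strictly above the spectral radius
  buys strict positivity. The witness is a partial Neumann series of \<open>M / c\<close> applied to
  the all-ones vector.\<close>

lemma exists_positive_supersolution:
  assumes M: "M \<in> carrier_mat d d" and d: "d \<ge> 1" and nn: "nonneg_matrix M"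
    and c: "real_spectral_radius M < c"
  shows "\<exists>v. \<forall>i<d. 0 < v i \<and> mat_apply d M v i \<le> c * v i"
proof -
  \<comment> \<open>The room between \<open>b\<close> and \<open>c\<close> makes
    \<open>(b / c) ^ k\<close> tend to 0.\<close>
  obtain b where b: "real_spectral_radius M < b" "b < c" using c dense by blast
  have b0: "0 < b" using b(1) real_spectral_radius_nonneg[OF M d] by simp
  have c0: "0 < c" using b b0 by simp
  obtain C where C: "\<And>k i j. i < d \<Longrightarrow> j < d \<Longrightarrow> \<bar>(M ^\<^sub>m k) $$ (i, j)\<bar> \<le> C * b ^ k"
    using pow_entries_bound[OF M d b(1)] by blast
  define s where "s k = (mat_apply d M ^^ k) (\<lambda>_. 1)" for k
  have s0: "s 0 i = 1" for i by (simp add: s_def)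
  have s_Suc: "s (Suc k) = mat_apply d M (s k)" for k by (simp add: s_def)
  have s_nonneg: "0 \<le> s k i" if "i < d" for k i
    using that by (induction k arbitrary: i) (auto simp: s0 s_Suc intro!: mat_apply_nonneg[OF nn M])
  have s_le: "s k i \<le> d * C * b ^ k" if "i < d" for k i
  proof -
    have "s k i = (\<Sum>j<d. (M ^\<^sub>m k) $$ (i, j))"
      using mat_apply_pow[OF M that, of k "\<lambda>_. 1"] that by (simp add: s_def mat_apply_def)
    also have "\<dots> \<le> (\<Sum>j<d. C * b ^ k)"
      using C[OF that] by (intro sum_mono) (auto intro: abs_le_D1)
    finally show ?thesis by simp
  qed
  have "(\<lambda>k. d * C * (b / c) ^ k) \<longlonglongrightarrow> d * C * 0"
    using b b0 c0 by (intro tendsto_intros LIMSEQ_power_zero) auto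
  then have "\<forall>\<^sub>F k in sequentially. d * C * (b / c) ^ k < 1"
    by (rule order_tendstoD) simp
  \<comment> \<open>\<open>K \<ge> 1\<close> keeps the term for \<open>k = 0\<close>, which equals
    1, in the series and so makes the series positive.\<close>
  from eventually_happens'[OF sequentially_bot eventually_conj[OF eventually_ge_at_top[of 1] this]]
  obtain K where K: "K \<ge> 1" "d * C * (b / c) ^ K < 1"
    by blast
  let ?f = "\<lambda>i k. (1 / c) ^ k * s k i"
  define v where "v i = (\<Sum>k<K. ?f i k)" for i
  have "0 < v i \<and> mat_apply d M v i \<le> c * v i" if i: "i < d" for i
  proof
    have "0 < ?f i 0" by (simp add: s0)
    also have "\<dots> \<le> v i" unfolding v_def
      using K(1) c0 s_nonneg[OF i] by (intro member_le_sum) auto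
    finally show "0 < v i" .
    have "?f i K \<le> (1 / c) ^ K * (d * C * b ^ K)"
      by (rule mult_left_mono) (use s_le[OF i] c0 in auto)
    also have "\<dots> < 1" using K(2) by (simp add: power_divide mult_ac)
    finally have fK: "?f i K \<le> 1" by simp
    \<comment> \<open>Applying \<open>M\<close> shifts the series by one index, up to the factor
      \<open>c\<close>. The new term \<open>?f i K\<close> is at most 1 and is paid for by the lost
      term \<open>?f i 0 = 1\<close>.\<close>
    have "mat_apply d M v i = (\<Sum>k<K. (1 / c) ^ k * s (Suc k) i)"
      unfolding v_def mat_apply_sum by (simp add: mat_apply_scale s_Suc)
    also have "\<dots> = c * (\<Sum>k<K. ?f i (Suc k))"
      using c0 by (simp add: sum_distrib_left)
    also have "(\<Sum>k<K. ?f i (Suc k)) = v i + ?f i K - ?f i 0"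
      using sum.lessThan_Suc_shift[of "?f i" K] unfolding v_def sum.lessThan_Suc by linarith
    also have "c * \<dots> \<le> c * v i"
      using fK c0 by (intro mult_left_mono) (auto simp: s0)
    finally show "mat_apply d M v i \<le> c * v i" .
  qed
  then show ?thesis by blast
qed

text \<open>Otherwise there is a positive supersolution \<open>v\<close> for some
  \<open>b < c\<close>. At the index that maximises \<open>x i / v i\<close> the entry
  \<open>x i\<close> is positive, and comparison with \<open>v\<close> gives
  \<open>c * x i \<le> b * x i\<close>.\<close>

lemma spectral_radius_ge_of_subsolution:
  assumes M: "M \<in> carrier_mat d d" and nn: "nonneg_matrix M"
    and i0: "i0 < d" "0 < x i0"
    and Mx: "\<And>i. i < d \<Longrightarrow> c * x i \<le> mat_apply d M x i"
  shows "c \<le> real_spectral_radius M"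
proof (rule ccontr)
  assume "\<not> ?thesis"
  then obtain b where b: "real_spectral_radius M < b" "b < c" using dense[of "real_spectral_radius M" c] by (auto simp: not_le)
  have d: "d \<ge> 1" using i0 by simp
  obtain v where v: "\<And>i. i < d \<Longrightarrow> 0 < v i" "\<And>i. i < d \<Longrightarrow> mat_apply d M v i \<le> b * v i"
    using exists_positive_supersolution[OF M d nn b(1)] by blast
  let ?f = "\<lambda>i. x i / v i"
  have fin: "finite (?f ` {..<d})" "?f ` {..<d} \<noteq> {}" using i0 by auto
  from Max_in[OF fin] obtain i where i: "i < d" "?f i = Max (?f ` {..<d})" by auto
  define t where "t = ?f i"
  have le: "?f j \<le> t" if "j < d" for j
    using Max_ge[OF fin(1), of "?f j"] that i(2) by (simp add: t_def)
  have t: "0 < t" using le[OF i0(1)] i0 v(1)[OF i0(1)]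
    by (meson divide_pos_pos less_le_trans)
  have xi: "x i = t * v i" using v(1)[OF i(1)] by (simp add: t_def)
  have "c * x i \<le> mat_apply d M x i" by (rule Mx[OF i(1)])
  also have "\<dots> \<le> mat_apply d M (\<lambda>j. t * v j) i"
    using le v(1) by (intro mat_apply_mono[OF nn M]) (auto simp: pos_divide_le_eq)
  also have "\<dots> \<le> t * (b * v i)"
    using v(2)[OF i(1)] t by (simp add: mat_apply_scale)
  also have "\<dots> = b * x i" by (simp add: xi)
  finally show False using b(2) t v(1)[OF i(1)] by (simp add: xi)
qed

section \<open>Fekete's lemma and norm estimates\<close>

text \<open>Fekete's lemma in multiplicative form. The limit is the infimum of the roots over
  \<open>n \<ge> 1\<close>, which yields the lower bound on every \<open>a n\<close>; the upper
  estimate divides \<open>n\<close> by a nearly optimal \<open>m\<close>.\<close>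

lemma fekete_root:
  fixes a :: "nat \<Rightarrow> real"
  assumes nonneg: "\<And>n. 0 \<le> a n" and sub: "\<And>m n. a (m + n) \<le> a m * a n"
  obtains L where "(\<lambda>n. root n (a n)) \<longlonglongrightarrow> L" "0 \<le> L" "\<And>n. n \<ge> 1 \<Longrightarrow> L ^ n \<le> a n"
proof -
  let ?B = "(\<lambda>n. root n (a n)) ` {1..}"
  define L where "L = Inf ?B"
  have bdd: "bdd_below ?B" by (rule bdd_belowI[of _ 0]) (auto simp: nonneg)
  have L_le: "L \<le> root n (a n)" if "n \<ge> 1" for n
    unfolding L_def using bdd that by (intro cInf_lower) auto
  have L0: "0 \<le> L" unfolding L_def by (rule cInf_greatest) (auto simp: nonneg)
  \<comment> \<open>The factor \<open>a 0\<close> covers \<open>q = 0\<close>. In the application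
    \<open>a 0\<close> is the norm of the identity, which can exceed 1.\<close>
  have pow: "a (q * m) \<le> a m ^ q * a 0" for q m
  proof (induction q)
    case (Suc q)
    have "a (Suc q * m) \<le> a m * a (q * m)" using sub[of m "q * m"] by simp
    also have "\<dots> \<le> a m * (a m ^ q * a 0)" using Suc nonneg by (intro mult_left_mono)
    finally show ?case by (simp add: mult.assoc)
  qed simp
  have "(\<lambda>n. root n (a n)) \<longlonglongrightarrow> L"
  proof (rule order_tendstoI)
    fix l assume "l < L"
    then have "l < root n (a n)" if "n \<ge> 1" for n using L_le[OF that] by simp
    then show "\<forall>\<^sub>F n in sequentially. l < root n (a n)"
      using eventually_sequentially by blast
  next
    fix u assume "L < u"
    then obtain c where c: "L < c" "c < u" using dense by blast
    have c0: "0 < c" using L0 c by simp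
    obtain m where m: "m \<ge> 1" "root m (a m) < c"
      using cInf_lessD[of ?B c] c(1) unfolding L_def by auto
    have am: "a m \<le> c ^ m"
    proof -
      have "root m (a m) ^ m \<le> c ^ m" using m nonneg by (intro power_mono) auto
      then show ?thesis using m nonneg by simp
    qed
    \<comment> \<open>One constant serves all remainders modulo \<open>m\<close>; adding 1 makes it
      positive, so that \<open>root n K\<close> tends to 1.\<close>
    define K where "K = a 0 * (\<Sum>r<m. a r / c ^ r) + 1"
    have K0: "0 < K" unfolding K_def using nonneg c0
      by (intro add_nonneg_pos mult_nonneg_nonneg sum_nonneg) auto
    have bound: "a n \<le> K * c ^ n" for n
    proof -
      let ?q = "n div m" and ?r = "n mod m"
      have "a n \<le> a (?q * m) * a ?r" using sub[of "?q * m" ?r] by simp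
      also have "\<dots> \<le> (a m ^ ?q * a 0) * a ?r" using pow nonneg by (intro mult_right_mono)
      also have "\<dots> \<le> ((c ^ m) ^ ?q * a 0) * a ?r"
        using am nonneg by (intro mult_right_mono power_mono)
      also have "\<dots> = a 0 * (a ?r / c ^ ?r) * (c ^ (m * ?q) * c ^ ?r)"
        using c0 by (simp add: power_mult)
      also have "c ^ (m * ?q) * c ^ ?r = c ^ n" by (simp flip: power_add)
      also have "a 0 * (a ?r / c ^ ?r) * c ^ n \<le> K * c ^ n"
      proof (intro mult_right_mono)
        have "a ?r / c ^ ?r \<le> (\<Sum>r<m. a r / c ^ r)"
          using m nonneg c0 by (intro member_le_sum) auto
        then have "a 0 * (a ?r / c ^ ?r) \<le> a 0 * (\<Sum>r<m. a r / c ^ r)"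
          using nonneg by (intro mult_left_mono)
        then show "a 0 * (a ?r / c ^ ?r) \<le> K" by (simp add: K_def)
      qed (use c0 in auto)
      finally show ?thesis .
    qed
    have "(\<lambda>n. root n K * c) \<longlonglongrightarrow> 1 * c"
      by (intro tendsto_intros LIMSEQ_root_const K0)
    then have "\<forall>\<^sub>F n in sequentially. root n K * c < u"
      using c(2) by (intro order_tendstoD) auto
    then show "\<forall>\<^sub>F n in sequentially. root n (a n) < u"
      using eventually_gt_at_top[of 0]
    proof eventually_elim
      case (elim n)
      have "root n (a n) \<le> root n (K * c ^ n)" using bound elim by simp
      also have "\<dots> = root n K * c" using elim c0 by (simp add: real_root_mult real_root_power_cancel)
      finally show ?case using elim by simp
    qed
  qed
  moreover have "L ^ n \<le> a n" if "n \<ge> 1" for n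
  proof -
    have "L ^ n \<le> root n (a n) ^ n" using L_le[OF that] L0 by (intro power_mono)
    then show ?thesis using that nonneg by simp
  qed
  ultimately show ?thesis using that L0 by blast
qed

lemma submultiplicative_normD:
  assumes "submultiplicative_norm d N" "M \<in> carrier_mat d d" "M' \<in> carrier_mat d d"
  shows "0 \<le> N M" "N (0\<^sub>m d d) = 0" "N (c \<cdot>\<^sub>m M) = \<bar>c\<bar> * N M"
    "N (M + M') \<le> N M + N M'" "N (M * M') \<le> N M * N M'"
  using assms unfolding submultiplicative_norm_def by auto

text \<open>Expand a matrix in the elementary matrices \<open>E p\<close> and apply the triangle
  inequality; \<open>D\<close> is the sum of the norms of the \<open>E p\<close>. This later turns
  entrywise bounds on products into bounds on \<open>N\<close>.\<close>

lemma norm_le_entries: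
  assumes N: "submultiplicative_norm d N"
  obtains D where "0 \<le> D"
    "\<And>M b. M \<in> carrier_mat d d \<Longrightarrow> (\<And>i j. i < d \<Longrightarrow> j < d \<Longrightarrow> \<bar>M $$ (i, j)\<bar> \<le> b) \<Longrightarrow> N M \<le> D * b"
proof -
  define E :: "nat \<times> nat \<Rightarrow> real mat" where "E p = mat d d (\<lambda>q. if q = p then 1 else 0)" for p
  have E: "E p \<in> carrier_mat d d" for p by (simp add: E_def)
  let ?I = "{..<d} \<times> {..<d}"
  have *: "N (mat d d (\<lambda>q. if q \<in> F then M $$ q else 0)) \<le> (\<Sum>p\<in>F. \<bar>M $$ p\<bar> * N (E p))"
    if "finite F" for F M
    using that
  proof induction
    case empty
    have "mat d d (\<lambda>q. 0) = (0\<^sub>m d d :: real mat)" by (auto intro!: eq_matI)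
    then show ?case using submultiplicative_normD(2)[OF N E E] by simp
  next
    case (insert p F)
    let ?F = "mat d d (\<lambda>q. if q \<in> F then M $$ q else 0)"
    have "mat d d (\<lambda>q. if q \<in> insert p F then M $$ q else 0) = ?F + M $$ p \<cdot>\<^sub>m E p"
      using insert(2) by (auto simp: E_def intro!: eq_matI)
    also have "N \<dots> \<le> N ?F + N (M $$ p \<cdot>\<^sub>m E p)"
      using E by (intro submultiplicative_normD(4)[OF N]) auto
    also have "N (M $$ p \<cdot>\<^sub>m E p) = \<bar>M $$ p\<bar> * N (E p)"
      by (rule submultiplicative_normD(3)[OF N E E])
    finally show ?case using insert by simp
  qed
  show ?thesis
  proof (rule that)
    show "0 \<le> (\<Sum>p\<in>?I. N (E p))"
      using submultiplicative_normD(1)[OF N E E] by (intro sum_nonneg)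
    fix M :: "real mat" and b
    assume M: "M \<in> carrier_mat d d" and b: "\<And>i j. i < d \<Longrightarrow> j < d \<Longrightarrow> \<bar>M $$ (i, j)\<bar> \<le> b"
    have "mat d d (\<lambda>q. if q \<in> ?I then M $$ q else 0) = M"
      using M by (auto intro!: eq_matI)
    then have "N M \<le> (\<Sum>p\<in>?I. \<bar>M $$ p\<bar> * N (E p))" using *[of ?I M] by simp
    also have "\<dots> \<le> (\<Sum>p\<in>?I. b * N (E p))"
      using b submultiplicative_normD(1)[OF N E E] by (intro sum_mono mult_right_mono) auto
    also have "\<dots> = (\<Sum>p\<in>?I. N (E p)) * b" by (simp add: sum_distrib_left mult.commute)
    finally show "N M \<le> (\<Sum>p\<in>?I. N (E p)) * b" .
  qed
qed

section \<open>Words and products of nonnegative matrices\<close>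

lemma finite_words: "finite (words k n)"
  using finite_lists_length_eq[of "{..<k}" n] by (simp add: words_def conj_commute)

lemma words_nonempty: "k \<ge> 1 \<Longrightarrow> words k n \<noteq> {}"
  by (auto simp: words_def intro!: exI[of _ "replicate n 0"])

lemma words_split: "w \<in> words k (m + n) \<Longrightarrow> \<exists>u\<in>words k m. \<exists>v\<in>words k n. w = u @ v"
  by (rule bexI[of _ "take m w"], rule bexI[of _ "drop m w"])
     (auto simp: words_def dest: in_set_takeD in_set_dropD)

lemma nonneg_matrix_mult:
  assumes "M \<in> carrier_mat d d" "M' \<in> carrier_mat d d" "nonneg_matrix M" "nonneg_matrix M'"
  shows "nonneg_matrix (M * M')"
  using assms unfolding nonneg_matrix_def
  by (auto simp: scalar_prod_def intro!: sum_nonneg mult_nonneg_nonneg)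

locale nonneg_system =
  fixes d k :: nat and A :: "nat \<Rightarrow> real mat"
  assumes d: "d \<ge> 1" and k: "k \<ge> 1"
    and carrier: "l < k \<Longrightarrow> A l \<in> carrier_mat d d"
    and nonneg: "l < k \<Longrightarrow> nonneg_matrix (A l)"
begin

abbreviation "P \<equiv> word_product d A"
abbreviation "S \<equiv> matrix_sum d k A"

lemma word_product_simps: "P [] = 1\<^sub>m d" "P (l # w) = A l * P w"
  by (simp_all add: word_product_def)

lemma word_product_carrier: "set w \<subseteq> {..<k} \<Longrightarrow> P w \<in> carrier_mat d d"
  by (induction w) (auto simp: word_product_simps intro!: mult_carrier_mat carrier)

lemma word_product_append:
  "set (u @ v) \<subseteq> {..<k} \<Longrightarrow> P (u @ v) = P u * P v"
proof (induction u)
  case Nil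
  then show ?case using word_product_carrier[of v] by (simp add: word_product_simps)
next
  case (Cons l u)
  then show ?case
    using assoc_mult_mat[OF carrier[of l] word_product_carrier[of u] word_product_carrier[of v]]
    by (simp add: word_product_simps)
qed

lemma word_product_nonneg: "set w \<subseteq> {..<k} \<Longrightarrow> nonneg_matrix (P w)"
proof (induction w)
  case Nil
  then show ?case by (simp add: word_product_simps nonneg_matrix_def)
next
  case (Cons l w)
  then show ?case unfolding word_product_simps
    by (intro nonneg_matrix_mult) (auto intro: carrier nonneg word_product_carrier)
qed

lemma sum_carrier: "S \<in> carrier_mat d d"
  by (simp add: matrix_sum_def)

lemma sum_nonneg_matrix: "nonneg_matrix S"
  by (auto simp: nonneg_matrix_def matrix_sum_def intro!: sum_nonneg nonneg_matrixD[OF nonneg carrier])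

lemma entry_le_sum: "l < k \<Longrightarrow> i < d \<Longrightarrow> j < d \<Longrightarrow> A l $$ (i, j) \<le> S $$ (i, j)"
  unfolding matrix_sum_def
  by (auto intro!: member_le_sum nonneg_matrixD[OF nonneg carrier])

lemma mat_apply_le_sum:
  assumes "l < k" "\<And>j. j < d \<Longrightarrow> 0 \<le> x j"
  shows "mat_apply d (A l) x i \<le> mat_apply d S x i"
  using assms by (auto simp: mat_apply_def intro!: sum_mono mult_right_mono entry_le_sum)

lemma mat_apply_word_append:
  "set (u @ v) \<subseteq> {..<k} \<Longrightarrow> mat_apply d (P (u @ v)) x = mat_apply d (P u) (mat_apply d (P v) x)"
  using mat_apply_mult[OF word_product_carrier word_product_carrier] by (simp add: word_product_append)

lemma mat_apply_word_Cons:
  "set (l # w) \<subseteq> {..<k} \<Longrightarrow> mat_apply d (P (l # w)) x = mat_apply d (A l) (mat_apply d (P w) x)"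
  using mat_apply_mult[OF carrier word_product_carrier] by (simp add: word_product_simps)

lemma mat_apply_word_nonneg:
  assumes "set w \<subseteq> {..<k}" "\<And>j. j < d \<Longrightarrow> 0 \<le> x j"
  shows "0 \<le> mat_apply d (P w) x i"
  by (rule mat_apply_nonneg[OF word_product_nonneg word_product_carrier]) (use assms in auto)

section \<open>Closed index sets and growth along words\<close>

text \<open>In the graph with an edge from \<open>a\<close> to \<open>j\<close> for each nonzero
  \<open>S $$ (a, j)\<close>, no edge leaves \<open>R\<close>. Hence the rows indexed by
  \<open>R\<close>, of \<open>S\<close> and of every word product, see only the values of a vector
  on \<open>R\<close>.\<close>

definition closed :: "nat set \<Rightarrow> bool" where
  "closed R \<longleftrightarrow> R \<subseteq> {..<d} \<and> (\<forall>a\<in>R. \<forall>j<d. S $$ (a, j) \<noteq> 0 \<longrightarrow> j \<in> R)"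

lemma closed_full: "closed {..<d}"
  by (auto simp: closed_def)

lemma mat_apply_cong_closed:
  assumes "closed R" "a \<in> R" "\<And>j. j \<in> R \<Longrightarrow> x j = y j"
  shows "mat_apply d S x a = mat_apply d S y a"
proof -
  have "S $$ (a, j) * x j = S $$ (a, j) * y j" if "j < d" for j
    using assms that by (cases "j \<in> R") (auto simp: closed_def)
  then have "(\<Sum>j<d. S $$ (a, j) * x j) = (\<Sum>j<d. S $$ (a, j) * y j)"
    by (intro sum.cong) auto
  then show ?thesis by (simp add: mat_apply_def)
qed

lemma letter_cong_closed:
  assumes "closed R" "a \<in> R" "l < k" "\<And>j. j \<in> R \<Longrightarrow> x j = y j"
  shows "mat_apply d (A l) x a = mat_apply d (A l) y a"
proof -
  have a: "a < d" using assms(1,2) by (auto simp: closed_def)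
  have "A l $$ (a, j) * x j = A l $$ (a, j) * y j" if "j < d" for j
  proof (cases "j \<in> R")
    case False
    then have "S $$ (a, j) = 0" using assms(1,2) that by (auto simp: closed_def)
    \<comment> \<open>By nonnegativity the entry of \<open>A l\<close> is squeezed between 0 and
      that of \<open>S\<close>.\<close>
    then have "A l $$ (a, j) = 0"
      using entry_le_sum[OF assms(3) a that] nonneg_matrixD[OF nonneg carrier a that] assms(3)
      by fastforce
    then show ?thesis by simp
  qed (use assms in auto)
  then have "(\<Sum>j<d. A l $$ (a, j) * x j) = (\<Sum>j<d. A l $$ (a, j) * y j)"
    by (intro sum.cong) auto
  then show ?thesis by (simp add: mat_apply_def)
qed

lemma word_cong_closed:
  assumes "closed R" "a \<in> R" "set w \<subseteq> {..<k}" "\<And>j. j \<in> R \<Longrightarrow> x j = y j"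
  shows "mat_apply d (P w) x a = mat_apply d (P w) y a"
  using assms(2,3)
proof (induction w arbitrary: a)
  case Nil
  then have "a < d" using assms(1) by (auto simp: closed_def)
  then show ?case using Nil assms(4) by (simp add: word_product_simps mat_apply_one)
next
  case (Cons l w)
  then show ?case
    unfolding mat_apply_word_Cons[OF Cons.prems(2)]
    by (intro letter_cong_closed[OF assms(1)]) auto
qed

lemma word_le_power:
  assumes R: "closed R" and a: "a \<in> R" and w: "set w \<subseteq> {..<k}"
    and u: "\<And>j. j < d \<Longrightarrow> 0 \<le> u j" and c: "0 \<le> c"
    and Su: "\<And>j. j \<in> R \<Longrightarrow> mat_apply d S u j \<le> c * u j"
  shows "mat_apply d (P w) u a \<le> c ^ length w * u a"
  using a w
proof (induction w arbitrary: a)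
  case Nil
  then have "a < d" using R by (auto simp: closed_def)
  then show ?case by (simp add: word_product_simps mat_apply_one)
next
  case (Cons l w)
  let ?x = "mat_apply d (P w) u" and ?y = "\<lambda>j. c ^ length w * u j"
  have l: "l < k" using Cons by simp
  \<comment> \<open>Monotonicity needs a comparison at every index, but the induction hypothesis
    speaks only of \<open>R\<close>. Outside \<open>R\<close> the vector is replaced by the bound
    itself, which leaves row \<open>a\<close> unchanged.\<close>
  let ?z = "\<lambda>j. if j \<in> R then ?x j else ?y j"
  have "mat_apply d (P (l # w)) u a = mat_apply d (A l) ?x a" using Cons by (simp add: mat_apply_word_Cons)
  also have "\<dots> = mat_apply d (A l) ?z a"
    using Cons.prems(1) l by (intro letter_cong_closed[OF R]) auto
  also have "\<dots> \<le> mat_apply d (A l) ?y a"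
    using Cons l by (intro mat_apply_mono[OF nonneg carrier]) auto
  also have "\<dots> = c ^ length w * mat_apply d (A l) u a" by (rule mat_apply_scale)
  also have "\<dots> \<le> c ^ length w * mat_apply d S u a"
    using mat_apply_le_sum[OF l u] c by (intro mult_left_mono) auto
  also have "\<dots> \<le> c ^ length w * (c * u a)"
    using Su[OF Cons.prems(1)] c by (intro mult_left_mono) auto
  finally show ?case by (simp add: mult_ac)
qed

text \<open>A positive supersolution of \<open>S\<close> for \<open>?c\<close> is one of
  \<open>P w\<close> for \<open>?c ^ length w\<close>, and \<open>?c\<close> can be taken
  arbitrarily close to the spectral radius of \<open>S\<close>.\<close>

lemma root_spectral_radius_word_le:
  assumes w: "set w \<subseteq> {..<k}" "w \<noteq> []"
  shows "root (length w) (real_spectral_radius (P w)) \<le> real_spectral_radius S"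
proof (rule field_le_epsilon)
  fix e :: real assume e: "0 < e"
  let ?c = "real_spectral_radius S + e"
  have c: "0 < ?c" using real_spectral_radius_nonneg[OF sum_carrier d] e by simp
  obtain v where v: "\<And>i. i < d \<Longrightarrow> 0 < v i" "\<And>i. i < d \<Longrightarrow> mat_apply d S v i \<le> ?c * v i"
    using exists_positive_supersolution[OF sum_carrier d sum_nonneg_matrix, of ?c] e by auto
  have "real_spectral_radius (P w) \<le> ?c ^ length w"
  proof (rule spectral_radius_le_of_supersolution[OF word_product_carrier d word_product_nonneg])
    fix i assume "i < d"
    then show "mat_apply d (P w) v i \<le> ?c ^ length w * v i"
      using v c w by (intro word_le_power[OF closed_full]) (auto intro: less_imp_le)
  qed (use v w in auto)
  then have "root (length w) (real_spectral_radius (P w)) \<le> root (length w) (?c ^ length w)"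
    using w by simp
  also have "\<dots> = ?c" using c w by (simp add: real_root_power_cancel)
  finally show "root (length w) (real_spectral_radius (P w)) \<le> ?c" .
qed

section \<open>The joint spectral radius and near-extremal words\<close>

text \<open>The maximal norms over words of length \<open>n\<close> are submultiplicative, so by
  Fekete's lemma the \<open>lim\<close> in the definition is a genuine limit. Its description as an
  infimum gives the bound at every finite length.\<close>

lemma joint_spectral_radius_power_le:
  assumes N: "submultiplicative_norm d N"
  shows "0 \<le> joint_spectral_radius N d k A"
    "n \<ge> 1 \<Longrightarrow> \<exists>w\<in>words k n. joint_spectral_radius N d k A ^ n \<le> N (P w)"
proof -
  define a where "a n = Max ((\<lambda>w. N (P w)) ` words k n)" for n
  have fin: "finite ((\<lambda>w. N (P w)) ` words k n)" "(\<lambda>w. N (P w)) ` words k n \<noteq> {}" for n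
    using finite_words words_nonempty[OF k] by auto
  have c: "P w \<in> carrier_mat d d" if "w \<in> words k n" for w n
    using that by (intro word_product_carrier) (auto simp: words_def)
  have a_ge: "N (P w) \<le> a n" if "w \<in> words k n" for w n
    unfolding a_def using that fin by (intro Max_ge) auto
  have a_in: "\<exists>w\<in>words k n. a n = N (P w)" for n
    using Max_in[OF fin[of n]] unfolding a_def by auto
  have a0: "0 \<le> a n" for n
    using a_in[of n] submultiplicative_normD(1)[OF N c c] by auto
  have sub: "a (m + n) \<le> a m * a n" for m n
  proof -
    obtain w where w: "w \<in> words k (m + n)" "a (m + n) = N (P w)" using a_in by blast
    obtain u v where uv: "u \<in> words k m" "v \<in> words k n" "w = u @ v"
      using words_split[OF w(1)] by blast
    have "P w = P u * P v" using w(1) uv(3) by (auto simp: words_def intro!: word_product_append)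
    then have "a (m + n) \<le> N (P u) * N (P v)"
      using submultiplicative_normD(5)[OF N c[OF uv(1)] c[OF uv(2)]] w by simp
    also have "\<dots> \<le> a m * a n"
      using uv submultiplicative_normD(1)[OF N c c] a0 by (intro mult_mono a_ge) auto
    finally show ?thesis .
  qed
  obtain L where L: "(\<lambda>n. root n (a n)) \<longlonglongrightarrow> L" "0 \<le> L" "\<And>n. n \<ge> 1 \<Longrightarrow> L ^ n \<le> a n"
    using fekete_root[OF a0 sub] by blast
  \<comment> \<open>Monotone functions commute with finite maxima; \<open>root 0\<close> is
    constantly 0.\<close>
  have "root n (a n) = Max ((\<lambda>w. root n (N (P w))) ` words k n)" for n
  proof -
    have "mono (root n)" by (cases "n = 0") (auto intro: monoI)
    from mono_Max_commute[OF this fin] show ?thesis by (simp add: a_def image_image)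
  qed
  then have "joint_spectral_radius N d k A = L"
    using limI[OF L(1)] by (simp add: joint_spectral_radius_def)
  then show "0 \<le> joint_spectral_radius N d k A"
    "n \<ge> 1 \<Longrightarrow> \<exists>w\<in>words k n. joint_spectral_radius N d k A ^ n \<le> N (P w)"
    using L(2) L(3)[of n] a_in[of n] by auto
qed

text \<open>Otherwise, in the sup norm weighted by \<open>v\<close>, all products of length
  \<open>n\<close> have norm at most some \<open>g < \<rho> ^ n\<close>. Products of
  \<open>q\<close> such blocks then have norm of order \<open>g ^ q\<close>, too small for
  \<open>\<rho>\<close> once \<open>q\<close> is large.\<close>

lemma exists_word_ge:
  assumes N: "submultiplicative_norm d N" and rho: "\<rho> = joint_spectral_radius N d k A" "0 < \<rho>"
    and n: "n \<ge> 1" and v: "\<And>i. i < d \<Longrightarrow> 0 < v i"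
  shows "\<exists>i<d. \<exists>w\<in>words k n. \<rho> ^ n * v i \<le> mat_apply d (P w) v i"
proof (rule ccontr)
  assume "\<not> ?thesis"
  then have less: "mat_apply d (P w) v i < \<rho> ^ n * v i" if "i < d" "w \<in> words k n" for i w
    using that by (auto simp: not_le)
  let ?T = "(\<lambda>(i, w). mat_apply d (P w) v i / v i) ` ({..<d} \<times> words k n)"
  have fin: "finite ?T" "?T \<noteq> {}"
    using finite_words words_nonempty[OF k] d by (auto simp: lessThan_empty_iff)
  define g where "g = Max ?T"
  have "g < \<rho> ^ n" unfolding g_def
    using fin less v by (subst Max_less_iff) (auto simp: pos_divide_less_eq)
  have set: "set w \<subseteq> {..<k}" if "w \<in> words k m" for w m
    using that by (auto simp: words_def)
  have g0: "0 \<le> g"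
  proof -
    obtain i w where iw: "i < d" "w \<in> words k n" "g = mat_apply d (P w) v i / v i"
      using Max_in[OF fin] unfolding g_def by auto
    then show ?thesis
      using mat_apply_word_nonneg[OF set[OF iw(2)], of v i] v by (simp add: less_imp_le)
  qed
  have g: "mat_apply d (P w) v i \<le> g * v i" if "i < d" "w \<in> words k n" for i w
  proof -
    have "mat_apply d (P w) v i / v i \<le> g"
      unfolding g_def using that fin by (intro Max_ge) auto
    then show ?thesis using v[OF that(1)] by (simp add: pos_divide_le_eq)
  qed
  have gq: "mat_apply d (P w) v i \<le> g ^ q * v i" if "i < d" "w \<in> words k (q * n)" for q i w
    using that
  proof (induction q arbitrary: i w)
    case 0
    then show ?case by (simp add: words_def word_product_simps mat_apply_one)
  next
    case (Suc q)
    then obtain x y where xy: "x \<in> words k n" "y \<in> words k (q * n)" "w = x @ y"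
      using words_split[of w k n "q * n"] by auto
    have "mat_apply d (P w) v i = mat_apply d (P x) (mat_apply d (P y) v) i"
      unfolding xy(3) by (subst mat_apply_word_append) (use set xy in auto)
    also have "\<dots> \<le> mat_apply d (P x) (\<lambda>j. g ^ q * v j) i"
      using Suc.IH xy set[OF xy(1)]
      by (intro mat_apply_mono[OF word_product_nonneg word_product_carrier]) auto
    also have "\<dots> = g ^ q * mat_apply d (P x) v i" by (rule mat_apply_scale)
    also have "\<dots> \<le> g ^ q * (g * v i)"
      using g[OF Suc.prems(1) xy(1)] g0 by (intro mult_left_mono) auto
    finally show ?case by (simp add: mult_ac)
  qed
  obtain D where D: "0 \<le> D"
    "\<And>M b. M \<in> carrier_mat d d \<Longrightarrow> (\<And>i j. i < d \<Longrightarrow> j < d \<Longrightarrow> \<bar>M $$ (i, j)\<bar> \<le> b) \<Longrightarrow> N M \<le> D * b"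
    using norm_le_entries[OF N] by blast
  \<comment> \<open>\<open>m\<close> dominates all ratios \<open>v i / v j\<close>, the price of
    passing from the weighted bound to bounds on entries.\<close>
  define m where "m = (\<Sum>i<d. \<Sum>j<d. v i / v j)"
  have ratio: "v i / v j \<le> m" if "i < d" "j < d" for i j
  proof -
    have "v i / v j \<le> (\<Sum>j<d. v i / v j)"
      using that v by (intro member_le_sum) (auto simp: less_imp_le)
    also have "\<dots> \<le> m"
      unfolding m_def using that v
      by (intro member_le_sum[where f = "\<lambda>i. \<Sum>j<d. v i / v j"] sum_nonneg) (auto simp: less_imp_le)
    finally show ?thesis .
  qed
  have bound: "(\<rho> ^ n) ^ q \<le> D * m * g ^ q" if "q \<ge> 1" for q
  proof -
    have qn: "q * n \<ge> 1" using that n by simp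
    obtain w where w: "w \<in> words k (q * n)" "\<rho> ^ (q * n) \<le> N (P w)"
      using joint_spectral_radius_power_le(2)[OF N qn] rho(1) by blast
    have "\<bar>P w $$ (i, j)\<bar> \<le> g ^ q * m" if ij: "i < d" "j < d" for i j
    proof -
      have nn: "0 \<le> P w $$ (i, l)" if "l < d" for l
        using nonneg_matrixD[OF word_product_nonneg word_product_carrier ij(1) that] set[OF w(1)]
        by blast
      have "P w $$ (i, j) * v j \<le> (\<Sum>j<d. P w $$ (i, j) * v j)"
        using ij v nn by (intro member_le_sum) (auto simp: less_imp_le)
      also have "\<dots> \<le> g ^ q * v i" using gq[OF ij(1) w(1)] ij by (simp add: mat_apply_def)
      finally have "P w $$ (i, j) \<le> g ^ q * (v i / v j)"
        using v[OF ij(2)] by (simp add: pos_le_divide_eq)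
      also have "\<dots> \<le> g ^ q * m" using ratio[OF ij] g0 by (intro mult_left_mono) auto
      finally show ?thesis using nn[OF ij(2)] by simp
    qed
    then have "N (P w) \<le> D * (g ^ q * m)"
      using set[OF w(1)] by (intro D(2) word_product_carrier)
    then show ?thesis using w(2) by (simp add: mult_ac flip: power_mult)
  qed
  have rn: "0 < \<rho> ^ n" using rho by simp
  have "(\<lambda>q. D * m * (g / \<rho> ^ n) ^ q) \<longlonglongrightarrow> D * m * 0"
    using \<open>g < \<rho> ^ n\<close> g0 rn by (intro tendsto_intros LIMSEQ_power_zero) auto
  then have "\<forall>\<^sub>F q in sequentially. D * m * (g / \<rho> ^ n) ^ q < 1"
    by (rule order_tendstoD) simp
  from eventually_happens'[OF sequentially_bot eventually_conj[OF eventually_ge_at_top[of 1] this]]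
  obtain q where q: "q \<ge> 1" "D * m * (g / \<rho> ^ n) ^ q < 1" by blast
  then have "D * m * g ^ q < (\<rho> ^ n) ^ q"
    using rn by (simp add: power_divide pos_divide_less_eq)
  then show False using bound[OF q(1)] by simp
qed

text \<open>One pair \<open>(i, w)\<close> serves every \<open>e\<close>, because there are finitely many pairs and the property is
  monotone in \<open>e\<close>.\<close>

lemma exists_uniform_word:
  assumes N: "submultiplicative_norm d N" and rho: "\<rho> = joint_spectral_radius N d k A" "0 < \<rho>"
    and eq: "\<rho> = real_spectral_radius S" and n: "n \<ge> 1"
  shows "\<exists>i<d. \<exists>w\<in>words k n. \<forall>e>0. \<exists>v. (\<forall>j<d. 0 < v j \<and> mat_apply d S v j \<le> (\<rho> + e) * v j) \<and>
    \<rho> ^ n * v i \<le> mat_apply d (P w) v i"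
proof (rule ccontr)
  let ?Q = "\<lambda>e p. \<exists>v. (\<forall>j<d. 0 < v j \<and> mat_apply d S v j \<le> (\<rho> + e) * v j) \<and>
    \<rho> ^ n * v (fst p) \<le> mat_apply d (P (snd p)) v (fst p)"
  let ?X = "{..<d} \<times> words k n"
  assume "\<not> ?thesis"
  then have "\<forall>p\<in>?X. \<exists>e>0. \<not> ?Q e p" by fastforce
  then obtain e where e: "\<And>p. p \<in> ?X \<Longrightarrow> 0 < e p" "\<And>p. p \<in> ?X \<Longrightarrow> \<not> ?Q (e p) p" by metis
  have fin: "finite (e ` ?X)" "e ` ?X \<noteq> {}"
    using finite_words words_nonempty[OF k] d by (auto simp: lessThan_empty_iff)
  define e0 where "e0 = Min (e ` ?X)"
  have e0: "0 < e0" unfolding e0_def using fin e(1) by (subst Min_gr_iff) auto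
  obtain v where v: "\<And>j. j < d \<Longrightarrow> 0 < v j" "\<And>j. j < d \<Longrightarrow> mat_apply d S v j \<le> (\<rho> + e0) * v j"
    using exists_positive_supersolution[OF sum_carrier d sum_nonneg_matrix, of "\<rho> + e0"] e0 eq by auto
  obtain i w where iw: "i < d" "w \<in> words k n" "\<rho> ^ n * v i \<le> mat_apply d (P w) v i"
    using exists_word_ge[OF N rho n, of v] v(1) by blast
  have "e0 \<le> e (i, w)" unfolding e0_def using fin iw by (intro Min_le) auto
  then have "mat_apply d S v j \<le> (\<rho> + e (i, w)) * v j" if "j < d" for j
    using v(2)[OF that] v(1)[OF that] by (smt (verit) mult_right_mono)
  then have "?Q (e (i, w)) (i, w)" using v(1) iw(3) by (intro exI[of _ v]) auto
  then show False using e(2)[of "(i, w)"] iw by blast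
qed

end

section \<open>Compactness and the limit vector\<close>

text \<open>Coordinates are handled one at a time: a monotone subsequence of a bounded sequence
  converges, and refining it further keeps the convergence already obtained.\<close>

lemma simultaneous_convergent_subseq:
  fixes r :: "nat \<Rightarrow> 'a \<Rightarrow> real"
  assumes "finite J" "\<And>j. j \<in> J \<Longrightarrow> Bseq (\<lambda>p. r p j)"
  shows "\<exists>f. strict_mono f \<and> (\<forall>j\<in>J. convergent (\<lambda>p. r (f p) j))"
  using assms
proof (induction J)
  case empty
  then show ?case using strict_mono_id by auto
next
  case (insert a J)
  then obtain f :: "nat \<Rightarrow> nat" where f: "strict_mono f" "\<forall>j\<in>J. convergent (\<lambda>p. r (f p) j)" by auto
  obtain g where g: "strict_mono g" "monoseq (\<lambda>p. r (f (g p)) a)"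
    using seq_monosub[of "\<lambda>p. r (f p) a"] by blast
  have fg: "strict_mono (f \<circ> g)" using f(1) g(1) by (rule strict_mono_o)
  have "Bseq (\<lambda>p. r (f (g p)) a)"
    using Bseq_subseq[of "\<lambda>p. r p a" "f \<circ> g"] insert.prems by (simp add: o_def)
  then have "convergent (\<lambda>p. r (f (g p)) a)"
    using g(2) by (rule Bseq_monoseq_convergent)
  moreover have "convergent (\<lambda>p. r (f (g p)) j)" if "j \<in> J" for j
    using convergent_subseq_convergent[OF f(2)[rule_format, OF that] g(1)] by (simp add: o_def)
  ultimately show ?case using fg by (intro exI[of _ "f \<circ> g"]) (simp add: o_def)
qed

context nonneg_system
begin

text \<open>The vectors \<open>v\<close> may blow up at different rates as \<open>e\<close> tends to \<open>0\<close>; only on the indices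
  reachable from \<open>i\<close> are the ratios to \<open>v i\<close> bounded, which is why \<open>R\<close> appears.\<close>

lemma exists_limit_vector:
  assumes i: "i < d" and w: "w \<in> words k n" and rho: "0 < \<rho>"
    and approx: "\<And>e. e > 0 \<Longrightarrow> \<exists>v. (\<forall>j<d. 0 < v j \<and> mat_apply d S v j \<le> (\<rho> + e) * v j) \<and>
      \<rho> ^ n * v i \<le> mat_apply d (P w) v i"
  obtains u R where "closed R" "i \<in> R" "\<And>j. 0 \<le> u j" "u i = 1"
    "\<And>a. a \<in> R \<Longrightarrow> mat_apply d S u a \<le> \<rho> * u a" "\<rho> ^ n \<le> mat_apply d (P w) u i"
proof -
  let ?e = "\<lambda>p::nat. 1 / real (Suc p)"
  have "\<forall>p. \<exists>v. (\<forall>j<d. 0 < v j \<and> mat_apply d S v j \<le> (\<rho> + ?e p) * v j) \<and>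
      \<rho> ^ n * v i \<le> mat_apply d (P w) v i" by (intro allI approx) simp
  then obtain v where v: "\<And>p j. j < d \<Longrightarrow> 0 < v p j"
    "\<And>p j. j < d \<Longrightarrow> mat_apply d S (v p) j \<le> (\<rho> + ?e p) * v p j"
    "\<And>p. \<rho> ^ n * v p i \<le> mat_apply d (P w) (v p) i" by metis
  define E where "E = {(a, b). a < d \<and> b < d \<and> S $$ (a, b) \<noteq> 0}"
  define R where "R = {j. (i, j) \<in> E\<^sup>*}"
  have iR: "i \<in> R" by (simp add: R_def)
  have Rd: "j < d" if "j \<in> R" for j
    using that i unfolding R_def mem_Collect_eq
    by (induction rule: rtrancl_induct) (auto simp: E_def)
  have R: "closed R"
    unfolding closed_def
  proof (intro conjI ballI allI impI)
    show "R \<subseteq> {..<d}" using Rd by auto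
    fix a j assume a: "a \<in> R" and j: "j < d" "S $$ (a, j) \<noteq> 0"
    then have "(a, j) \<in> E" using Rd[OF a] by (simp add: E_def)
    then show "j \<in> R" using a unfolding R_def mem_Collect_eq by (metis rtrancl.rtrancl_into_rtrancl)
  qed
  \<comment> \<open>Bounds propagate along edges: row \<open>a\<close> of the supersolution
    inequality controls \<open>S $$ (a, b) * v p b\<close>. The factor \<open>\<rho> + 1\<close>
    serves all \<open>p\<close> because \<open>?e p \<le> 1\<close>.\<close>
  have bounded: "\<exists>B\<ge>0. \<forall>p. v p j \<le> B * v p i" if "j \<in> R" for j
    using that unfolding R_def mem_Collect_eq
  proof (induction rule: rtrancl_induct)
    case base
    show ?case by (intro exI[of _ 1]) auto
  next
    case (step a b)
    then obtain B where B: "B \<ge> 0" "\<And>p. v p a \<le> B * v p i" by blast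
    have ab: "a < d" "b < d" "0 < S $$ (a, b)"
      using step(2) nonneg_matrixD[OF sum_nonneg_matrix sum_carrier, of a b]
      by (auto simp: E_def less_le)
    have "v p b \<le> ((\<rho> + 1) * B / S $$ (a, b)) * v p i" for p
    proof -
      have "S $$ (a, b) * v p b \<le> (\<Sum>j<d. S $$ (a, j) * v p j)"
        using ab nonneg_matrixD[OF sum_nonneg_matrix sum_carrier] v(1)
        by (intro member_le_sum) (auto simp: less_imp_le)
      also have "\<dots> \<le> (\<rho> + ?e p) * v p a" using v(2)[OF ab(1)] ab by (simp add: mat_apply_def)
      also have "\<dots> \<le> (\<rho> + 1) * (B * v p i)"
        using B v(1)[OF ab(1)] rho by (intro mult_mono) (auto simp: less_imp_le)
      finally show ?thesis using ab by (simp add: pos_le_divide_eq mult_ac)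
    qed
    then show ?case using B(1) ab rho by (intro exI[of _ "(\<rho> + 1) * B / S $$ (a, b)"]) auto
  qed
  \<comment> \<open>Outside \<open>R\<close> the ratios may be unbounded and are set to 0; since
    \<open>R\<close> is closed, this does not affect the rows indexed by \<open>R\<close>.\<close>
  define r where "r p j = (if j \<in> R then v p j / v p i else 0)" for p j
  have r0: "0 \<le> r p j" for p j using v(1) i Rd by (auto simp: r_def less_imp_le)
  have "Bseq (\<lambda>p. r p j)" for j
  proof (cases "j \<in> R")
    case True
    then obtain B where B: "\<And>p. v p j \<le> B * v p i" using bounded by blast
    have "r p j \<le> B" for p
      using B[of p] v(1)[OF i] True by (simp add: r_def pos_divide_le_eq)
    then have "norm (r p j) \<le> B" for p
      using r0[of p j] by (simp only: real_norm_def abs_of_nonneg)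
    then show ?thesis by (rule BseqI')
  qed (auto simp: r_def intro: BseqI')
  then obtain f where f: "strict_mono f" "\<forall>j\<in>{..<d}. convergent (\<lambda>p. r (f p) j)"
    using simultaneous_convergent_subseq[of "{..<d}" r] by auto
  define u where "u j = (if j < d then lim (\<lambda>p. r (f p) j) else 0)" for j
  have u: "(\<lambda>p. r (f p) j) \<longlonglongrightarrow> u j" if "j < d" for j
    using f(2) that by (simp add: u_def convergent_LIMSEQ_iff)
  have mat_apply_lim: "(\<lambda>p. mat_apply d M (r (f p)) a) \<longlonglongrightarrow> mat_apply d M u a" if "a < d" for M a
    using that u unfolding mat_apply_def by (auto intro!: tendsto_intros)
  have div: "mat_apply d M (\<lambda>j. v p j / v p i) a = mat_apply d M (v p) a / v p i" for M p a
    using mat_apply_scale[of d M "inverse (v p i)" "v p" a] by (simp add: divide_inverse mult.commute)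
  show ?thesis
  proof (rule that[OF R iR])
    show "0 \<le> u j" for j
      using LIMSEQ_le_const[OF u, of j 0] r0 by (cases "j < d") (auto simp: u_def)
    have "r p i = 1" for p using v(1)[OF i, of p] iR by (simp add: r_def)
    then show "u i = 1" using i by (simp add: u_def)
    have "\<rho> ^ n \<le> mat_apply d (P w) (r p) i" for p
    proof -
      have "mat_apply d (P w) (r p) i = mat_apply d (P w) (\<lambda>j. v p j / v p i) i"
        using w by (intro word_cong_closed[OF R iR]) (auto simp: words_def r_def)
      then show ?thesis using v(3)[of p] v(1)[OF i, of p] by (simp add: div pos_le_divide_eq)
    qed
    then show "\<rho> ^ n \<le> mat_apply d (P w) u i"
      using LIMSEQ_le_const[OF mat_apply_lim[OF i]] by blast
    fix a assume a: "a \<in> R"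
    have "mat_apply d S (r p) a \<le> (\<rho> + ?e p) * r p a" for p
    proof -
      have "mat_apply d S (r p) a = mat_apply d S (\<lambda>j. v p j / v p i) a"
        using a by (intro mat_apply_cong_closed[OF R]) (auto simp: r_def)
      then show ?thesis
        using v(2)[OF Rd[OF a], of p] v(1)[OF i, of p] a by (simp add: div r_def divide_right_mono)
    qed
    moreover have "(\<lambda>p. (\<rho> + ?e (f p)) * r (f p) a) \<longlonglongrightarrow> (\<rho> + 0) * u a"
      using LIMSEQ_subseq_LIMSEQ[OF lim_1_over_n[THEN LIMSEQ_Suc] f(1)] u[OF Rd[OF a]]
      by (intro tendsto_intros) (auto simp: o_def)
    ultimately show "mat_apply d S u a \<le> \<rho> * u a"
      using LIMSEQ_le[OF mat_apply_lim[OF Rd[OF a]]] by auto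
  qed
qed

section \<open>Pigeonhole on reachable index sets\<close>

text \<open>For \<open>j\<close> outside \<open>R\<close> the indicator of \<open>j\<close> agrees
  with the zero vector on \<open>R\<close>, so row \<open>a\<close> of the product maps it to
  0.\<close>

lemma word_entry_closed:
  assumes "closed R" "a \<in> R" "set w \<subseteq> {..<k}" "j < d" "P w $$ (a, j) \<noteq> 0"
  shows "j \<in> R"
proof (rule ccontr)
  assume j: "j \<notin> R"
  have a: "a < d" using assms by (auto simp: closed_def)
  let ?x = "\<lambda>l. if l = j then 1 else 0 :: real"
  have "mat_apply d (P w) ?x a = mat_apply d (P w) (\<lambda>_. 0) a"
    using j by (intro word_cong_closed[OF assms(1-3)]) auto
  moreover have "mat_apply d (P w) ?x a = (\<Sum>l<d. if l = j then P w $$ (a, l) else 0)"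
    using a by (auto simp: mat_apply_def simp del: sum.delta sum.delta' intro!: sum.cong)
  ultimately show False using assms(4,5) a by (simp add: mat_apply_def)
qed

text \<open>Let \<open>z\<close> be the factor of \<open>w\<close> between two prefixes that reach
  the same set. On that set the rows of \<open>P z\<close> use only columns of the set, and
  \<open>u\<close> is scaled by exactly \<open>\<rho> ^ length z\<close>; so its restriction is a
  subsolution for \<open>P z\<close>.\<close>

lemma exists_word_spectral_radius_ge:
  assumes R: "closed R" "i \<in> R" and u: "\<And>j. 0 \<le> u j" "u i = 1"
    and Su: "\<And>a. a \<in> R \<Longrightarrow> mat_apply d S u a \<le> \<rho> * u a" and rho: "0 < \<rho>"
    and w: "w \<in> words k n" and n: "n = 2 ^ d" and ge: "\<rho> ^ n \<le> mat_apply d (P w) u i"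
  shows "\<exists>z. set z \<subseteq> {..<k} \<and> z \<noteq> [] \<and> \<rho> ^ length z \<le> real_spectral_radius (P z)"
proof -
  have i: "i < d" using R by (auto simp: closed_def)
  have len: "length w = n" and set: "set w \<subseteq> {..<k}" using w by (auto simp: words_def)
  have set_take: "set (take t w) \<subseteq> {..<k}" and set_drop: "set (drop t w) \<subseteq> {..<k}" for t
    using set by (auto dest: in_set_takeD in_set_dropD)
  have split: "mat_apply d (P w) u = mat_apply d (P (take t w)) (mat_apply d (P (drop t w)) u)" for t
    using mat_apply_word_append[of "take t w" "drop t w" u] set by simp
  have nn: "0 \<le> P x $$ (a, b)" if "set x \<subseteq> {..<k}" "a < d" "b < d" for x a b
    using nonneg_matrixD[OF word_product_nonneg word_product_carrier] that by blast
  have upper: "mat_apply d (P x) u a \<le> \<rho> ^ length x * u a" if "a \<in> R" "set x \<subseteq> {..<k}" for a x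
    using that u(1) rho Su by (intro word_le_power[OF R(1)]) auto
  define T where "T t = {j. j < d \<and> P (take t w) $$ (i, j) \<noteq> 0}" for t
  have TR: "j \<in> R" if "j \<in> T t" for j t
    using word_entry_closed[OF R set_take] that by (auto simp: T_def)
  \<comment> \<open>Both parts of \<open>w\<close> obey the bound \<open>upper\<close>. A strict
    deficit at an index of \<open>T t\<close> enters row \<open>i\<close> with positive weight and
    would push \<open>mat_apply d (P w) u i\<close> below \<open>\<rho> ^ n\<close>.\<close>
  have tight: "mat_apply d (P (drop t w)) u j = \<rho> ^ (n - t) * u j" if t: "t \<le> n" and j: "j \<in> T t" for t j
  proof (rule ccontr)
    let ?M = "P (take t w)" and ?y = "mat_apply d (P (drop t w)) u" and ?q = "\<lambda>j. \<rho> ^ (n - t) * u j"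
    assume neq: "?y j \<noteq> ?q j"
    have le: "?y l \<le> ?q l" if "l \<in> T t" for l
      using upper[OF TR[OF that] set_drop[of t]] len by simp
    have "(\<Sum>l<d. ?M $$ (i, l) * ?y l) < (\<Sum>l<d. ?M $$ (i, l) * ?q l)"
    proof (rule sum_strict_mono_ex1)
      show "\<forall>l\<in>{..<d}. ?M $$ (i, l) * ?y l \<le> ?M $$ (i, l) * ?q l"
      proof
        fix l assume l: "l \<in> {..<d}"
        show "?M $$ (i, l) * ?y l \<le> ?M $$ (i, l) * ?q l"
          using le[of l] nn[OF set_take i, of l t] l
          by (cases "l \<in> T t") (auto simp: T_def intro: mult_left_mono)
      qed
      have "?M $$ (i, j) * ?y j < ?M $$ (i, j) * ?q j"
        using le[OF j] neq j nn[OF set_take i, of j t] by (intro mult_strict_left_mono) (auto simp: T_def)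
      then show "\<exists>l\<in>{..<d}. ?M $$ (i, l) * ?y l < ?M $$ (i, l) * ?q l"
        using j by (auto simp: T_def)
    qed simp
    then have "mat_apply d (P w) u i < mat_apply d ?M ?q i"
      unfolding split[of t] using i by (simp add: mat_apply_def)
    also have "\<dots> = \<rho> ^ (n - t) * mat_apply d ?M u i" by (rule mat_apply_scale)
    also have "\<dots> \<le> \<rho> ^ (n - t) * (\<rho> ^ t * u i)"
      using upper[OF R(2) set_take[of t]] t len rho by (intro mult_left_mono) auto
    also have "\<dots> = \<rho> ^ n" using t u(2) by (simp flip: power_add)
    finally show False using ge by simp
  qed
  \<comment> \<open>There are \<open>2 ^ d + 1\<close> prefix lengths from 0 to \<open>n\<close> but
    at most \<open>2 ^ d\<close> sets \<open>T t\<close>.\<close>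
  obtain s t where st: "s < t" "t \<le> n" "T s = T t"
  proof -
    have "T ` {..n} \<subseteq> Pow {..<d}" by (auto simp: T_def)
    then have "card (T ` {..n}) \<le> 2 ^ d"
      using card_mono[of "Pow {..<d}"] by (simp add: card_Pow)
    then have "\<not> inj_on T {..n}" by (intro pigeonhole) (simp add: n)
    then obtain a b where "a \<le> n" "b \<le> n" "a \<noteq> b" "T a = T b" by (auto simp: inj_on_def)
    then show ?thesis using that[of a b] that[of b a] by (cases "a < b") auto
  qed
  define z where "z = take (t - s) (drop s w)"
  have z: "set z \<subseteq> {..<k}" "length z = t - s"
    using set st len by (auto simp: z_def dest: in_set_takeD in_set_dropD)
  have drop_s: "drop s w = z @ drop t w"
    using st append_take_drop_id[of "t - s" "drop s w"] by (simp add: z_def)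
  have take_t: "take t w = take s w @ z"
    using st take_add[of s "t - s" w] by (simp add: z_def)
  \<comment> \<open>Nonnegativity excludes cancellation: a positive entry at \<open>a\<close> for
    the shorter prefix times a positive entry of \<open>P z\<close> makes the entry at
    \<open>b\<close> for the longer prefix positive, so \<open>b \<in> T t = T s\<close>.\<close>
  have closed_T: "b \<in> T s" if a: "a \<in> T s" and b: "b < d" "P z $$ (a, b) \<noteq> 0" for a b
  proof -
    have ad: "a < d" using a by (simp add: T_def)
    have "0 < P (take s w) $$ (i, a) * P z $$ (a, b)"
      using a b nn[OF set_take i ad, of s] nn[OF z(1) ad b(1)] by (auto simp: T_def less_le)
    also have "\<dots> \<le> (\<Sum>l<d. P (take s w) $$ (i, l) * P z $$ (l, b))"
      using ad b nn[OF set_take i] nn[OF z(1)]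
      by (intro member_le_sum[where f = "\<lambda>l. P (take s w) $$ (i, l) * P z $$ (l, b)"]) auto
    also have "\<dots> = P (take t w) $$ (i, b)"
      using word_product_append[of "take s w" z] word_product_carrier[OF set_take[of s]]
        word_product_carrier[OF z(1)] set_take[of s] z(1) i b
      by (simp add: take_t scalar_prod_def lessThan_atLeast0)
    finally show ?thesis using b st(3) by (simp add: T_def)
  qed
  let ?x = "\<lambda>j. if j \<in> T s then u j else 0"
  \<comment> \<open>The subsolution needs a positive entry. If \<open>u\<close> vanished on
    \<open>T s\<close>, tightness would make \<open>mat_apply d (P w) u i\<close> zero.\<close>
  have "\<exists>j\<in>T s. 0 < u j"
  proof (rule ccontr)
    assume "\<not> ?thesis"
    then have "u j = 0" if "j \<in> T s" for j using u(1)[of j] that by force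
    then have "P (take s w) $$ (i, l) * mat_apply d (P (drop s w)) u l = 0" if "l < d" for l
      using tight[of s l] st that by (cases "l \<in> T s") (auto simp: T_def)
    then have "(\<Sum>l<d. P (take s w) $$ (i, l) * mat_apply d (P (drop s w)) u l) = 0"
      by (intro sum.neutral) auto
    then have "mat_apply d (P w) u i = 0"
      unfolding split[of s] mat_apply_def[of d "P (take s w)"] by simp
    then show False using ge zero_less_power[OF rho, of n] by simp
  qed
  then obtain j0 where j0: "j0 \<in> T s" "0 < u j0" by blast
  have "\<rho> ^ length z \<le> real_spectral_radius (P z)"
  proof (rule spectral_radius_ge_of_subsolution[OF word_product_carrier word_product_nonneg])
    show "j0 < d" "0 < ?x j0" using j0 by (auto simp: T_def)
    fix a assume a: "a < d"
    show "\<rho> ^ length z * ?x a \<le> mat_apply d (P z) ?x a"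
    proof (cases "a \<in> T s")
      case True
      let ?y = "mat_apply d (P (drop t w)) u"
      have "\<rho> ^ (n - s) * u a = mat_apply d (P z) ?y a"
        using tight[of s a] True st mat_apply_word_append[of z "drop t w" u] z(1) set_drop[of t]
        by (simp add: drop_s)
      \<comment> \<open>By \<open>closed_T\<close> only columns in \<open>T s = T t\<close>
        contribute, and there tightness at \<open>t\<close> evaluates \<open>?y\<close>.\<close>
      also have "\<dots> = (\<Sum>b<d. P z $$ (a, b) * (\<rho> ^ (n - t) * ?x b))"
        unfolding mat_apply_def[of d "P z"] if_P[OF a]
      proof (intro sum.cong refl)
        fix b assume b: "b \<in> {..<d}"
        show "P z $$ (a, b) * ?y b = P z $$ (a, b) * (\<rho> ^ (n - t) * ?x b)"
          using closed_T[OF True, of b] tight[of t b] st b by (cases "P z $$ (a, b) = 0") auto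
      qed
      also have "\<dots> = \<rho> ^ (n - t) * mat_apply d (P z) ?x a"
        using a by (simp add: mat_apply_def sum_distrib_left mult.left_commute)
      also have "\<rho> ^ (n - s) = \<rho> ^ (n - t) * \<rho> ^ length z"
        using st z(2) by (simp flip: power_add)
      finally show ?thesis using rho True by simp
    qed (use mat_apply_word_nonneg[OF z(1), of ?x a] u(1) in auto)
  qed (use z in auto)
  moreover have "z \<noteq> []" using z(2) st(1) by auto
  ultimately show ?thesis using z(1) by blast
qed

end

theorem corollary2:
  fixes d k :: nat and A :: "nat \<Rightarrow> real mat" and N :: "real mat \<Rightarrow> real"
  assumes "d \<ge> 1" and "k \<ge> 1"
    and "submultiplicative_norm d N"
    and "\<And>l. l < k \<Longrightarrow> A l \<in> carrier_mat d d"
    and "\<And>l. l < k \<Longrightarrow> nonneg_matrix (A l)"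
    and "joint_spectral_radius N d k A = real_spectral_radius (matrix_sum d k A)"
  shows "finiteness_property N d k A"
proof -
  interpret nonneg_system d k A by unfold_locales (use assms in auto)
  let ?\<rho> = "joint_spectral_radius N d k A"
  have "\<exists>z. set z \<subseteq> {..<k} \<and> z \<noteq> [] \<and> ?\<rho> ^ length z \<le> real_spectral_radius (P z)"
  \<comment> \<open>When the joint spectral radius is 0 the one-letter word \<open>[0]\<close>
    already works; the limit argument divides by positive powers of it.\<close>
  proof (cases "?\<rho> = 0")
    case True
    have "set [0] \<subseteq> {..<k}" using assms(2) by auto
    then show ?thesis
      using True real_spectral_radius_nonneg[OF word_product_carrier assms(1), of "[0]"]
      by (intro exI[of _ "[0]"]) simp
  next
    case False
    then have rho: "0 < ?\<rho>" using joint_spectral_radius_power_le(1)[OF assms(3)] by simp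
    obtain i w where iw: "i < d" "w \<in> words k (2 ^ d)"
      "\<And>e. e > 0 \<Longrightarrow> \<exists>v. (\<forall>j<d. 0 < v j \<and> mat_apply d S v j \<le> (?\<rho> + e) * v j) \<and>
        ?\<rho> ^ 2 ^ d * v i \<le> mat_apply d (P w) v i"
      using exists_uniform_word[OF assms(3) refl rho assms(6), of "2 ^ d"] by auto
    obtain u R where "closed R" "i \<in> R" "\<And>j. 0 \<le> u j" "u i = 1"
      "\<And>a. a \<in> R \<Longrightarrow> mat_apply d S u a \<le> ?\<rho> * u a" "?\<rho> ^ 2 ^ d \<le> mat_apply d (P w) u i"
      using exists_limit_vector[OF iw(1,2) rho iw(3)] by metis
    then show ?thesis
      using rho iw(2) by (intro exists_word_spectral_radius_ge[where n = "2 ^ d"]) auto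
  qed
  then obtain z where z: "set z \<subseteq> {..<k}" "z \<noteq> []" "?\<rho> ^ length z \<le> real_spectral_radius (P z)"
    by blast
  have "?\<rho> = root (length z) (?\<rho> ^ length z)"
    using z(2) joint_spectral_radius_power_le(1)[OF assms(3)] by (simp add: real_root_power_cancel)
  also have "\<dots> \<le> root (length z) (real_spectral_radius (P z))" using z by simp
  \<comment> \<open>Conversely, the root is at most the spectral radius of the sum, which by
    hypothesis equals the joint spectral radius.\<close>
  finally have "root (length z) (real_spectral_radius (P z)) = ?\<rho>"
    using root_spectral_radius_word_le[OF z(1,2)] assms(6) by simp
  moreover have "z \<in> words k (length z)" "length z \<ge> 1"
    using z by (auto simp: words_def Suc_le_eq)
  ultimately show ?thesis unfolding finiteness_property_def by blast
qed

end
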